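(* Let $\mathcal{M}_{\mathrm{Li}}(n)$ and $\mathcal{M}_{\mathrm{Sh}}(n)$ denote the number of canonical encodings, for a sentence with $n$ words, of the linear-chain model and of the Shared hypergraph model respectively (both defined in the context). Then the relative ambiguity of the linear-chain model over the Shared model is greater than $1$: $$\mathcal{A}_r(\mathrm{Li},\mathrm{Sh}) \;=\; \lim_{n\to\infty}\frac{\log\sum_{i=1}^{n}\mathcal{M}_{\mathrm{Sh}}(i)}{\log\sum_{i=1}^{n}\mathcal{M}_{\mathrm{Li}}(i)} \;>\; 1 .$$
   Context: **Mentions.** A sentence with $n$ words is identified with its positions $\{1,\dots,n\}$. There is a single entity type. A mention (entity) is a nonempty subset of $\{1,\dots,n\}$. Its components are its maximal runs of consecutive positions, and a mention has at most $3$ components. It is contiguous if it has exactly one component and discontiguous otherwise. A mention combination is an arbitrary (possibly empty) set of mentions; mentions may overlap. **Canonical encodings and relative ambiguity.** A model assigns to each mention combination one fixed selected representation, its canonical encoding; distinct mention combinations may share the same encoding. For a model $M$, $\mathcal{M}_M(n)$ is the number of distinct canonical encodings over all mention combinations of a sentence with $n$ words. The relative ambiguity of $M_1$ over $M_2$ is $$\mathcal{A}_r(M_1,M_2)=\lim_{n\to\infty}\frac{\log\sum_{i=1}^n\mathcal{M}_{M_2}(i)}{\log\sum_{i=1}^n\mathcal{M}_{M_1}(i)} .$$ **Linear-chain model (Li).** A mention combination is encoded as a sequence in $\{\mathbf{B},\mathbf{I},\mathbf{O},\mathbf{BD},\mathbf{ID},\mathbf{BH},\mathbf{IH}\}^n$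 by labelling each position $k$ as follows. - If $k$ lies in at least two mentions, it is a head word. It is labelled $\mathbf{IH}$ if at least two of the mentions contain both $k-1$ and $k$ (so $k$ continues a contiguous word sequence shared by multiple mentions), and $\mathbf{BH}$ otherwise. - If $k$ lies in exactly one mention and that mention is discontiguous, it is labelled $\mathbf{BD}$ if $k$ is the first word of its component in that mention, and $\mathbf{ID}$ otherwise. - If $k$ lies in exactly one mention and that mention is contiguous, it is labelled $\mathbf{B}$ if $k$ is the first word of that mention, and $\mathbf{I}$ otherwise. - If $k$ lies in no mention, it is labelled $\mathbf{O}$. $\mathcal{M}_{\mathrm{Li}}(n)$ is the number of distinct label sequences of length $n$ obtained from mention combinations in this way. **Shared hypergraph model (Sh).** For each position $k\in\{1,\dots,n\}$ there are nodes $A^k$, $E^k$, $T^k$, $B_0^k$, $B_1^k$, $B_2^k$, $O_1^k$, $O_2^k$, and there is one special leaf node $X$ (end of a mention). The node $B_i^k$ means that word $k$ is in the component with index $i$ (components are indexed from $0$) of a mention; $O_i^k$ means that word $k$ lies in the gap between the components with indices $i-1$ and $i$. Each directed hyperedge connects one parent to a nonempty set of children. The hyperedges are as follows, where a hyperedge exists only if all its children exist (in particular there are no nodes at position $n+1$): - $A^k\to\{E^k,A^{k+1}\}$ for $k<n$, and $A^n\to\{E^n\}$; - $E^k\to\{T^k\}$; - $T^k\to\{B_0^k\}$ and $T^k\to\{X\}$; - for $i=0,1$: $B_i^k\to S$ for every nonempty $S\subseteq\{B_i^{k+1},O_{i+1}^{k+1},X\}$; - $B_2^k\to S$ for every nonempty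 $S\subseteq\{B_2^{k+1},X\}$; - for $i=1,2$: $O_i^k\to S$ for every nonempty $S\subseteq\{O_i^{k+1},B_i^{k+1}\}$. An entity-encoded hypergraph is a subgraph consisting of a set of nodes and hyperedges such that: $A^1$ is included; every included node other than $X$ is the parent of exactly one included hyperedge; all children of included hyperedges are included; and every included node is reachable from $A^1$ through included hyperedges. A mention with components indexed $0,1,\dots$ corresponds to the path that starts $T^k\to B_0^k$ at its first word $k$, follows the $B_i$ and $O_i$ nodes of its successive words and gap words, and ends at $X$ after its last word. The encoding of a mention combination is the entity-encoded hypergraph in which each node's chosen hyperedge has as children exactly those children used by some mention of the combination (with $T^k\to\{X\}$ if no mention starts at $k$). The canonical encodings are exactly the entity-encoded hypergraphs, so $\mathcal{M}_{\mathrm{Sh}}(n)$ is the number of distinct entity-encoded hypergraphs for a sentence with $n$ words. *)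

theory Defs
  imports Complex_Main
begin

section \<open>Mentions\<close>

text \<open>Positions are numbered from 1, so 0 never belongs to a mention.\<close>

definition components :: "nat set \<Rightarrow> nat set set" where
  "components m =
     {C. \<exists>a b. a \<le> b \<and> C = {a..b} \<and> C \<subseteq> m \<and> (a = 0 \<or> a - 1 \<notin> m) \<and> Suc b \<notin> m}"

definition mentions :: "nat \<Rightarrow> nat set set" where
  "mentions n = {m. m \<noteq> {} \<and> m \<subseteq> {1..n} \<and> card (components m) \<le> 3}"

definition contiguous :: "nat set \<Rightarrow> bool" where
  "contiguous m \<longleftrightarrow> card (components m) = 1"

definition mention_combinations :: "nat \<Rightarrow> nat set set set" where
  "mention_combinations n = Pow (mentions n)"


section \<open>Relative ambiguity\<close>

text \<open>A model enters only through its number of canonical encodings as a function of the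
  sentence length.\<close>

definition ambiguity_ratio :: "(nat \<Rightarrow> nat) \<Rightarrow> (nat \<Rightarrow> nat) \<Rightarrow> nat \<Rightarrow> real" where
  "ambiguity_ratio M1 M2 n = ln (real (\<Sum>i=1..n. M2 i)) / ln (real (\<Sum>i=1..n. M1 i))"

text \<open>Meaningful only if the ratio converges.\<close>

definition relative_ambiguity :: "(nat \<Rightarrow> nat) \<Rightarrow> (nat \<Rightarrow> nat) \<Rightarrow> real" where
  "relative_ambiguity M1 M2 = lim (ambiguity_ratio M1 M2)"


section \<open>The linear-chain model\<close>

datatype li_label = LB | LI | LO | LBD | LID | LBH | LIH

definition li_label_at :: "nat set set \<Rightarrow> nat \<Rightarrow> li_label" where
  "li_label_at F k =
    (let cover = {m \<in> F. k \<in> m} in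
     if card cover \<ge> 2 then
       (if card {m \<in> F. k - 1 \<in> m \<and> k \<in> m} \<ge> 2 then LIH else LBH)
     else if card cover = 1 then
       (let m = the_elem cover in
        if contiguous m then (if k = Min m then LB else LI)
        else (if \<exists>C \<in> components m. k = Min C then LBD else LID))
     else LO)"

definition li_encoding :: "nat \<Rightarrow> nat set set \<Rightarrow> li_label list" where
  "li_encoding n F = map (li_label_at F) [1..<Suc n]"

definition M_Li :: "nat \<Rightarrow> nat" where
  "M_Li n = card (li_encoding n ` mention_combinations n)"


section \<open>The Shared hypergraph model\<close>

text \<open>\<open>NB i k\<close> is the node $B_i^k$ and \<open>NO i k\<close> is the node $O_i^k$: the component index
  comes first, then the position.\<close>

datatype sh_node = NA nat | NE nat | NT nat | NB nat nat | NO nat nat | NX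

definition sh_nodes :: "nat \<Rightarrow> sh_node set" where
  "sh_nodes n =
     {NX} \<union> NA ` {1..n} \<union> NE ` {1..n} \<union> NT ` {1..n}
     \<union> {NB i k | i k. i \<in> {0, 1, 2} \<and> k \<in> {1..n}}
     \<union> {NO i k | i k. i \<in> {1, 2} \<and> k \<in> {1..n}}"

text \<open>A hyperedge is the pair of its parent and its set of children. Intersecting with
  \<^term>\<open>sh_nodes n\<close> removes the candidate children at position \<open>n + 1\<close>.\<close>

inductive_set sh_hyperedges :: "nat \<Rightarrow> (sh_node \<times> sh_node set) set" for n :: nat where
  A_step: "1 \<le> k \<Longrightarrow> k < n \<Longrightarrow> (NA k, {NE k, NA (Suc k)}) \<in> sh_hyperedges n"
| A_last: "1 \<le> n \<Longrightarrow> (NA n, {NE n}) \<in> sh_hyperedges n"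
| E_T: "k \<in> {1..n} \<Longrightarrow> (NE k, {NT k}) \<in> sh_hyperedges n"
| T_B: "k \<in> {1..n} \<Longrightarrow> (NT k, {NB 0 k}) \<in> sh_hyperedges n"
| T_X: "k \<in> {1..n} \<Longrightarrow> (NT k, {NX}) \<in> sh_hyperedges n"
| B_01: "k \<in> {1..n} \<Longrightarrow> i \<in> {0, 1} \<Longrightarrow> S \<noteq> {} \<Longrightarrow>
    S \<subseteq> {NB i (Suc k), NO (Suc i) (Suc k), NX} \<inter> sh_nodes n \<Longrightarrow>
    (NB i k, S) \<in> sh_hyperedges n"
| B_2: "k \<in> {1..n} \<Longrightarrow> S \<noteq> {} \<Longrightarrow> S \<subseteq> {NB 2 (Suc k), NX} \<inter> sh_nodes n \<Longrightarrow>
    (NB 2 k, S) \<in> sh_hyperedges n"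
| O_12: "k \<in> {1..n} \<Longrightarrow> i \<in> {1, 2} \<Longrightarrow> S \<noteq> {} \<Longrightarrow>
    S \<subseteq> {NO i (Suc k), NB i (Suc k)} \<inter> sh_nodes n \<Longrightarrow>
    (NO i k, S) \<in> sh_hyperedges n"

definition hyperedge_steps :: "('v \<times> 'v set) set \<Rightarrow> ('v \<times> 'v) set" where
  "hyperedge_steps H = {(p, c). \<exists>S. (p, S) \<in> H \<and> c \<in> S}"

definition entity_encoded_hypergraph ::
    "nat \<Rightarrow> sh_node set \<times> (sh_node \<times> sh_node set) set \<Rightarrow> bool" where
  "entity_encoded_hypergraph n G \<longleftrightarrow>
    (case G of (V, H) \<Rightarrow>
       V \<subseteq> sh_nodes n \<and> H \<subseteq> sh_hyperedges n \<and>
       NA 1 \<in> V \<and>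
       (\<forall>v \<in> V - {NX}. \<exists>!e. e \<in> H \<and> fst e = v) \<and>
       (\<forall>e \<in> H. fst e \<in> V \<and> snd e \<subseteq> V) \<and>
       (\<forall>v \<in> V. (NA 1, v) \<in> (hyperedge_steps H)\<^sup>*))"

text \<open>The canonical encodings of mention combinations are exactly the entity-encoded
  hypergraphs: a combination yields the hypergraph formed by its paths, and every entity-encoded
  hypergraph is the encoding of the combination of all its paths.\<close>

definition M_Sh :: "nat \<Rightarrow> nat" where
  "M_Sh n = card {G. entity_encoded_hypergraph n G}"

end

theory Submission
  imports Defs
begin

text \<open>Encodings of a sentence with \<open>m\<close> words and of one with \<open>n\<close> words can be concatenated, in both
  models, so the two counting functions are supermultiplicative. By Fekete's lemma each of them
  grows like \<open>exp (L * n)\<close> up to subexponential factors, where \<open>L\<close> is the supremum of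
  \<open>ln (M n) / n\<close>, and the relative ambiguity is the quotient of the two rates. The linear-chain rate
  is at most \<open>ln 7\<close> because there are seven labels; for the Shared model it exceeds \<open>ln 7\<close>, since
  already eight words admit at least \<open>2 ^ 24 > 7 ^ 8\<close> hypergraphs.\<close>


section \<open>Growth rates of supermultiplicative sequences\<close>

lemma superadditive_mult_le:
  fixes u :: "nat \<Rightarrow> real"
  assumes super: "\<And>m n. 1 \<le> m \<Longrightarrow> 1 \<le> n \<Longrightarrow> u m + u n \<le> u (m + n)"
    and "1 \<le> k" "1 \<le> q"
  shows "real q * u k \<le> u (q * k)"
  using \<open>1 \<le> q\<close>
proof (induction q rule: dec_induct)
  case base
  then show ?case by simp
next
  case (step q)
  have "u k + u (q * k) \<le> u (k + q * k)"
    using step.hyps \<open>1 \<le> k\<close> by (intro super) auto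
  with step.IH show ?case by (simp add: algebra_simps)
qed

text \<open>Write n as (n div k) * k + n mod k; nonnegativity allows the remainder term to be
  dropped. Superadditivity is assumed for positive arguments only, so a vanishing quotient or
  remainder is treated separately.\<close>

lemma superadditive_div_le:
  fixes u :: "nat \<Rightarrow> real"
  assumes super: "\<And>m n. 1 \<le> m \<Longrightarrow> 1 \<le> n \<Longrightarrow> u m + u n \<le> u (m + n)"
    and nonneg: "\<And>n. 1 \<le> n \<Longrightarrow> 0 \<le> u n"
    and k: "1 \<le> k" and n: "1 \<le> n"
  shows "real (n div k) * u k \<le> u n"
proof (cases "n div k = 0")
  case True
  with nonneg[OF n] show ?thesis by simp
next
  case False
  then have *: "real (n div k) * u k \<le> u (n div k * k)"
    using super k by (intro superadditive_mult_le) auto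
  show ?thesis
  proof (cases "n mod k = 0")
    case True
    then have "n div k * k = n" by (metis add_0_right div_mult_mod_eq)
    with * show ?thesis by simp
  next
    case neq: False
    have "u (n div k * k) + u (n mod k) \<le> u (n div k * k + n mod k)"
      using False neq k by (intro super) auto
    moreover have "0 \<le> u (n mod k)" using neq by (intro nonneg) simp
    ultimately show ?thesis using * by simp
  qed
qed

text \<open>Fekete's lemma for nonnegative sequences: choose k with u k / k close to the supremum;
  division with remainder then shows that u n / n falls below u k / k by at most u k / n.\<close>

lemma superadditive_tendsto_SUP:
  fixes u :: "nat \<Rightarrow> real"
  assumes super: "\<And>m n. 1 \<le> m \<Longrightarrow> 1 \<le> n \<Longrightarrow> u m + u n \<le> u (m + n)"
    and nonneg: "\<And>n. 1 \<le> n \<Longrightarrow> 0 \<le> u n"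
    and bdd: "bdd_above ((\<lambda>n. u n / n) ` {1..})"
  shows "(\<lambda>n. u n / n) \<longlonglongrightarrow> (SUP n\<in>{1..}. u n / n)"
proof (rule LIMSEQ_I)
  let ?L = "SUP n\<in>{1..}. u n / n"
  fix e :: real assume "0 < e"
  then have "?L - e / 2 < ?L" by simp
  then obtain k where k: "1 \<le> k" and Lk: "?L - e / 2 < u k / k"
    by (subst (asm) less_cSUP_iff[OF _ bdd]) auto
  \<comment> \<open>From N on, u k / n, the error caused by rounding n / k down to an integer, is
    smaller than e / 2.\<close>
  obtain N where N: "u k / (e / 2) < real N"
    using reals_Archimedean2 by blast
  show "\<exists>no. \<forall>n\<ge>no. norm (u n / n - ?L) < e"
  proof (intro exI allI impI)
    fix n assume n: "max 1 N \<le> n"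
    then have n1: "1 \<le> n" by simp
    have upper: "u n / n \<le> ?L"
      using n1 by (intro cSUP_upper[OF _ bdd]) simp
    have "real n = real (n div k) * real k + real (n mod k)"
      by (metis div_mult_mod_eq of_nat_add of_nat_mult)
    also have "\<dots> \<le> (real (n div k) + 1) * real k"
      using k mod_less_divisor[of k n] by (simp add: algebra_simps)
    finally have "real n / real k - 1 \<le> real (n div k)"
      using k by (simp add: field_simps)
    then have "(real n / real k - 1) * u k \<le> u n"
      using superadditive_div_le[OF super nonneg k n1] nonneg[OF k]
      by (meson mult_right_mono order_trans)
    then have "(real n / real k - 1) * u k / n \<le> u n / n"
      by (intro divide_right_mono) auto
    moreover have "(real n / real k - 1) * u k / n = u k / k - u k / n"
      using n1 k by (simp add: field_simps)
    moreover have "u k / n < e / 2"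
    proof -
      have "u k / (e / 2) < real n" using N n by linarith
      then show ?thesis using \<open>0 < e\<close> n1 by (simp add: field_simps)
    qed
    ultimately have "?L - e < u n / n" using Lk by linarith
    with upper show "norm (u n / n - ?L) < e" using \<open>0 < e\<close> by simp
  qed
qed

text \<open>Fekete's lemma applies to ln (M n), and the partial sums have the same rate because they
  lie between M n and n * exp (L * n). As L is a supremum, a single value of M bounds it from below,
  while the exponential bound C ^ n bounds it from above.\<close>

lemma supermultiplicative_growth_rate:
  fixes M :: "nat \<Rightarrow> nat" and C :: real
  assumes super: "\<And>m n. 1 \<le> m \<Longrightarrow> 1 \<le> n \<Longrightarrow> M m * M n \<le> M (m + n)"
    and pos: "\<And>n. 1 \<le> n \<Longrightarrow> 1 \<le> M n"
    and "0 < C" and bound: "\<And>n. 1 \<le> n \<Longrightarrow> real (M n) \<le> C ^ n"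
  obtains L where "(\<lambda>n. ln (real (\<Sum>i=1..n. M i)) / n) \<longlonglongrightarrow> L"
    and "\<And>n. 1 \<le> n \<Longrightarrow> ln (real (M n)) / n \<le> L" and "L \<le> ln C"
proof -
  define u where "u n = ln (real (M n))" for n
  define L where "L = (SUP n\<in>{1..}. u n / n)"
  have u_add: "u m + u n \<le> u (m + n)" if "1 \<le> m" "1 \<le> n" for m n
  proof -
    have "u m + u n = ln (real (M m * M n))"
      using pos[OF that(1)] pos[OF that(2)] by (simp add: u_def ln_mult)
    also have "\<dots> \<le> u (m + n)"
      unfolding u_def using super[OF that] pos[OF that(1)] pos[OF that(2)] pos[of "m + n"] that
      by (subst ln_le_cancel_iff) (auto simp flip: of_nat_mult)
    finally show ?thesis .
  qed
  have u_nonneg: "0 \<le> u n" if "1 \<le> n" for n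
    using pos[OF that] by (simp add: u_def)
  have u_upper: "u n / n \<le> ln C" if "1 \<le> n" for n
  proof -
    have "u n \<le> ln (C ^ n)"
      unfolding u_def using bound[OF that] pos[OF that] \<open>0 < C\<close>
      by (subst ln_le_cancel_iff) auto
    then show ?thesis using that \<open>0 < C\<close> by (simp add: ln_realpow field_simps)
  qed
  have bdd: "bdd_above ((\<lambda>n. u n / n) ` {1..})"
    using u_upper by (auto intro!: bdd_aboveI2)
  have lim: "(\<lambda>n. u n / n) \<longlonglongrightarrow> L"
    unfolding L_def using u_add u_nonneg bdd by (rule superadditive_tendsto_SUP)
  have u_le: "u n / n \<le> L" if "1 \<le> n" for n
    unfolding L_def using that by (intro cSUP_upper[OF _ bdd]) simp
  have L_le: "L \<le> ln C"
    unfolding L_def using u_upper by (intro cSUP_least) auto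
  \<comment> \<open>This makes exp (L * i) increasing in i, so the last summand of the majorant
    dominates the others.\<close>
  have L_nonneg: "0 \<le> L"
    using u_le[of 1] u_nonneg[of 1] by simp
  have M_le: "real (M n) \<le> exp (L * n)" if "1 \<le> n" for n
  proof -
    have "u n \<le> L * n" using u_le[OF that] that by (simp add: field_simps)
    moreover have "real (M n) = exp (u n)" using pos[OF that] by (simp add: u_def)
    ultimately show ?thesis by simp
  qed
  have lower: "u n / n \<le> ln (real (\<Sum>i=1..n. M i)) / n" if "1 \<le> n" for n
  proof -
    have "M n \<le> (\<Sum>i=1..n. M i)" using that by (intro member_le_sum) auto
    then have "u n \<le> ln (real (\<Sum>i=1..n. M i))"
      unfolding u_def using pos[OF that] by (subst ln_le_cancel_iff) linarith+
    then show ?thesis by (intro divide_right_mono) auto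
  qed
  \<comment> \<open>Each of the n summands is at most exp (L * n); the factor n costs only the
    vanishing term ln n / n.\<close>
  have upper: "ln (real (\<Sum>i=1..n. M i)) / n \<le> ln (real n) / n + L" if "1 \<le> n" for n
  proof -
    have "M n \<le> (\<Sum>i=1..n. M i)" using that by (intro member_le_sum) auto
    then have sum_pos: "0 < real (\<Sum>i=1..n. M i)" using pos[OF that] by linarith
    have "real (\<Sum>i=1..n. M i) = (\<Sum>i=1..n. real (M i))" by simp
    also have "\<dots> \<le> (\<Sum>i=1..n. exp (L * n))"
    proof (rule sum_mono)
      fix i assume i: "i \<in> {1..n}"
      then have "real (M i) \<le> exp (L * i)" by (intro M_le) simp
      also have "\<dots> \<le> exp (L * n)" using i L_nonneg by (simp add: mult_left_mono)
      finally show "real (M i) \<le> exp (L * n)" .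
    qed
    also have "\<dots> = n * exp (L * n)" by simp
    finally have "ln (real (\<Sum>i=1..n. M i)) \<le> ln (n * exp (L * n))"
      using sum_pos that by (subst ln_le_cancel_iff) auto
    also have "\<dots> = ln (real n) + L * n" using that by (simp add: ln_mult)
    finally have "ln (real (\<Sum>i=1..n. M i)) / n \<le> (ln (real n) + L * n) / n"
      by (intro divide_right_mono) auto
    then show ?thesis using that by (simp add: add_divide_distrib)
  qed
  have "(\<lambda>n. ln (real n) / n + L) \<longlonglongrightarrow> 0 + L"
    by (intro tendsto_intros filterlim_compose[OF ln_x_over_x_tendsto_0 filterlim_real_sequentially])
  then have lim': "(\<lambda>n. ln (real n) / n + L) \<longlonglongrightarrow> L" by simp
  have "(\<lambda>n. ln (real (\<Sum>i=1..n. M i)) / n) \<longlonglongrightarrow> L"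
  proof (rule tendsto_sandwich[OF _ _ lim lim'])
    show "\<forall>\<^sub>F n in sequentially. u n / n \<le> ln (real (\<Sum>i=1..n. M i)) / n"
      using eventually_ge_at_top[of 1] by eventually_elim (rule lower)
    show "\<forall>\<^sub>F n in sequentially. ln (real (\<Sum>i=1..n. M i)) / n \<le> ln (real n) / n + L"
      using eventually_ge_at_top[of 1] by eventually_elim (rule upper)
  qed
  then show ?thesis using u_le[unfolded u_def] L_le by (rule that)
qed


section \<open>Concatenation in the linear-chain model\<close>

text \<open>Maximal runs are translated to maximal runs. Since 0 is not in x, every run starts at a
  positive position, where the truncated predecessor commutes with the translation.\<close>

lemma components_shift:
  assumes "0 \<notin> x"
  shows "components ((+) d ` x) = (`) ((+) d) ` components x"
proof (intro equalityI subsetI)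
  fix C assume "C \<in> components ((+) d ` x)"
  then obtain a b where ab: "a \<le> b" "C = {a..b}" "C \<subseteq> (+) d ` x"
    "a = 0 \<or> a - 1 \<notin> (+) d ` x" "Suc b \<notin> (+) d ` x"
    unfolding components_def by blast
  have "a \<in> (+) d ` x" using ab by auto
  then obtain a' where a': "a = d + a'" "a' \<in> x" by auto
  with assms have "a' \<noteq> 0" by metis
  \<comment> \<open>No truncation occurs in this subtraction, because d \<le> a \<le> b.\<close>
  define b' where "b' = b - d"
  have b': "b = d + b'" "a' \<le> b'" using ab(1) a' by (auto simp: b'_def)
  have C: "C = (+) d ` {a'..b'}"
    using ab(2) a' b' by (simp add: image_add_atLeastAtMost add.commute)
  have "{a'..b'} \<subseteq> x"
    using ab(3) unfolding C by (simp add: inj_image_subset_iff del: image_add_atLeastAtMost)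
  moreover have "a' - 1 \<notin> x"
  proof
    assume "a' - 1 \<in> x"
    then have "d + (a' - 1) \<in> (+) d ` x" by simp
    moreover have "d + (a' - 1) = a - 1" "a \<noteq> 0" using a' \<open>a' \<noteq> 0\<close> by auto
    ultimately show False using ab(4) by metis
  qed
  moreover have "Suc b' \<notin> x"
    using ab(5) b' by (metis add_Suc_right imageI)
  ultimately have "{a'..b'} \<in> components x"
    using b' unfolding components_def by blast
  with C show "C \<in> (`) ((+) d) ` components x" by blast
next
  fix C assume "C \<in> (`) ((+) d) ` components x"
  then obtain a b where ab: "a \<le> b" "C = (+) d ` {a..b}" "{a..b} \<subseteq> x"
    "a = 0 \<or> a - 1 \<notin> x" "Suc b \<notin> x"
    unfolding components_def by blast
  have "a \<in> x" using ab by auto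
  with assms have "a \<noteq> 0" by metis
  have "C = {d + a..d + b}" using ab(2) by (simp add: add.commute)
  moreover have "C \<subseteq> (+) d ` x" using ab by blast
  moreover have "d + a - 1 = d + (a - 1)" using \<open>a \<noteq> 0\<close> by simp
  moreover have "d + y \<notin> (+) d ` x" if "y \<notin> x" for y using that by auto
  ultimately have "C = {d + a..d + b}" "C \<subseteq> (+) d ` x" "d + a - 1 \<notin> (+) d ` x"
    using ab(4) \<open>a \<noteq> 0\<close> by metis+
  moreover have "Suc (d + b) \<notin> (+) d ` x" using ab(5) by (auto simp flip: add_Suc_right)
  ultimately show "C \<in> components ((+) d ` x)"
    unfolding components_def using ab(1) by (smt (verit) add_le_cancel_left mem_Collect_eq)
qed

lemma inj_image_shift: "inj ((`) ((+) (d::nat)))"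
  by (rule injI) (simp add: inj_image_eq_iff)

lemma card_components_shift:
  "0 \<notin> x \<Longrightarrow> card (components ((+) d ` x)) = card (components x)"
  by (simp add: components_shift card_image inj_on_subset[OF inj_image_shift])

lemma Min_shift:
  fixes x :: "nat set"
  shows "finite x \<Longrightarrow> x \<noteq> {} \<Longrightarrow> Min ((+) d ` x) = d + Min x"
  by (rule mono_Min_commute[symmetric]) (auto simp: mono_def)

lemma componentsD:
  assumes "C \<in> components x"
  shows "finite C" "C \<noteq> {}"
  using assms unfolding components_def by auto

text \<open>The mentions counted for \<open>LIH\<close> contain k as well as k - 1, so they too are
  found among the mentions covering k.\<close>

lemma li_label_at_cong:
  assumes "{x \<in> F. k \<in> x} = {x \<in> G. k \<in> x}"
  shows "li_label_at F k = li_label_at G k"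
proof -
  have "{x \<in> F. k - 1 \<in> x \<and> k \<in> x} = {x \<in> G. k - 1 \<in> x \<and> k \<in> x}"
    using assms by blast
  with assms show ?thesis unfolding li_label_at_def by simp
qed

text \<open>Everything a label inspects commutes with translation: the two cardinalities,
  contiguity, and the first words of the mention and of its components.\<close>

lemma li_label_at_shift:
  assumes F: "\<And>x. x \<in> F \<Longrightarrow> 0 \<notin> x \<and> finite x" and "1 \<le> k"
  shows "li_label_at ((`) ((+) d) ` F) (d + k) = li_label_at F k"
proof -
  let ?s = "(`) ((+) d) :: nat set \<Rightarrow> nat set"
  have cover: "{x \<in> ?s ` F. d + k \<in> x} = ?s ` {x \<in> F. k \<in> x}" by auto
  have "d + k - 1 = d + (k - 1)" using \<open>1 \<le> k\<close> by simp
  then have "{x \<in> ?s ` F. d + k - 1 \<in> x \<and> d + k \<in> x} = ?s ` {x \<in> F. k - 1 \<in> x \<and> k \<in> x}"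
    by auto
  moreover have card_s: "card (?s ` X) = card X" for X
    by (simp add: card_image inj_on_subset[OF inj_image_shift])
  moreover
  \<comment> \<open>Only when exactly one mention covers k does the label look inside it, and only
    then does \<open>the_elem\<close> denote that mention.\<close>
  {
    assume "card {x \<in> F. k \<in> x} = 1"
    then obtain x where x: "{x \<in> F. k \<in> x} = {x}" by (rule card_1_singletonE)
    then have "x \<in> F" "k \<in> x" by blast+
    then have fin: "finite x" "0 \<notin> x" using F by auto
    have "contiguous (?s x) = contiguous x"
      unfolding contiguous_def using fin by (simp add: card_components_shift)
    moreover have "d + k = Min (?s x) \<longleftrightarrow> k = Min x"
      using fin \<open>k \<in> x\<close> by (subst Min_shift) auto
    moreover have "(\<exists>C\<in>components (?s x). d + k = Min C) \<longleftrightarrow> (\<exists>C\<in>components x. k = Min C)"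
      using fin componentsD by (auto simp: components_shift Min_shift)
    ultimately have "(let m = the_elem (?s ` {x \<in> F. k \<in> x}) in
        if contiguous m then (if d + k = Min m then LB else LI)
        else (if \<exists>C\<in>components m. d + k = Min C then LBD else LID)) =
      (let m = the_elem {x \<in> F. k \<in> x} in
        if contiguous m then (if k = Min m then LB else LI)
        else (if \<exists>C\<in>components m. k = Min C then LBD else LID))"
      by (simp add: x)
  }
  ultimately show ?thesis
    unfolding li_label_at_def by (simp add: cover Let_def)
qed

lemma mentionsD:
  assumes "x \<in> mentions n"
  shows "0 \<notin> x" "finite x" "x \<subseteq> {1..n}"
  using assms unfolding mentions_def by (auto dest: finite_subset)

text \<open>The mentions of F stay within the first m positions and the translated mentions of G lie
  beyond them. No position is covered from both sides, and a label depends only on the mentions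
  covering its position, so there is no interaction at the boundary.\<close>

lemma li_encoding_append:
  assumes F: "F \<in> mention_combinations m" and G: "G \<in> mention_combinations n"
  shows "F \<union> (`) ((+) m) ` G \<in> mention_combinations (m + n)"
    and "li_encoding (m + n) (F \<union> (`) ((+) m) ` G) = li_encoding m F @ li_encoding n G"
proof -
  let ?FG = "F \<union> (`) ((+) m) ` G"
  have F': "x \<in> mentions m" if "x \<in> F" for x
    using F that unfolding mention_combinations_def by blast
  have G': "x \<in> mentions n" if "x \<in> G" for x
    using G that unfolding mention_combinations_def by blast
  have "x \<in> mentions (m + n)" if "x \<in> F" for x
    using F'[OF that] unfolding mentions_def by auto
  moreover have "(+) m ` x \<in> mentions (m + n)" if "x \<in> G" for x
    using G'[OF that] mentionsD[OF G'[OF that]] card_components_shift[of x m]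
    unfolding mentions_def by auto
  ultimately show "?FG \<in> mention_combinations (m + n)"
    unfolding mention_combinations_def by blast
  have left: "li_label_at ?FG k = li_label_at F k" if "k \<le> m" for k
  proof (rule li_label_at_cong)
    have "k \<notin> (+) m ` x" if "x \<in> G" for x
      using mentionsD(1)[OF G'[OF that]] \<open>k \<le> m\<close> by auto
    then show "{x \<in> ?FG. k \<in> x} = {x \<in> F. k \<in> x}" by auto
  qed
  have right: "li_label_at ?FG (m + k) = li_label_at G k" if "1 \<le> k" for k
  proof -
    have "m + k \<notin> x" if "x \<in> F" for x
      using mentionsD(3)[OF F'[OF that]] \<open>1 \<le> k\<close> by auto
    then have "li_label_at ?FG (m + k) = li_label_at ((`) ((+) m) ` G) (m + k)"
      by (intro li_label_at_cong) auto
    also have "\<dots> = li_label_at G k"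
      using mentionsD[OF G'] that by (intro li_label_at_shift) auto
    finally show ?thesis .
  qed
  have "[1..<Suc (m + n)] = [1..<Suc m] @ map ((+) m) [1..<Suc n]"
    by (rule nth_equalityI) (auto simp: nth_append)
  then show "li_encoding (m + n) ?FG = li_encoding m F @ li_encoding n G"
    unfolding li_encoding_def by (auto simp del: upt_Suc simp: left right)
qed

section \<open>Bounds for the number of label sequences\<close>

lemma finite_mention_combinations: "finite (mention_combinations n)"
proof -
  have "mentions n \<subseteq> Pow {1..n}" unfolding mentions_def by auto
  then show ?thesis unfolding mention_combinations_def by (simp add: finite_subset)
qed

lemma length_li_encoding [simp]: "length (li_encoding n F) = n"
  by (simp add: li_encoding_def del: upt_Suc)

text \<open>Concatenation is injective here because the first factors all have length m.\<close>

lemma M_Li_supermult: "M_Li m * M_Li n \<le> M_Li (m + n)"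
proof -
  let ?E = "\<lambda>n. li_encoding n ` mention_combinations n"
  have "M_Li m * M_Li n = card (?E m \<times> ?E n)"
    by (simp add: M_Li_def card_cartesian_product)
  also have "\<dots> = card ((\<lambda>(xs, ys). xs @ ys) ` (?E m \<times> ?E n))"
    by (intro card_image[symmetric]) (auto simp: inj_on_def)
  also have "\<dots> \<le> M_Li (m + n)"
    unfolding M_Li_def
  proof (intro card_mono subsetI)
    fix zs assume "zs \<in> (\<lambda>(xs, ys). xs @ ys) ` (?E m \<times> ?E n)"
    then obtain F G where "F \<in> mention_combinations m" "G \<in> mention_combinations n"
      "zs = li_encoding m F @ li_encoding n G" by auto
    then show "zs \<in> ?E (m + n)" using li_encoding_append by (metis imageI)
  qed (simp add: finite_mention_combinations)
  finally show ?thesis .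
qed

lemma M_Li_le: "M_Li n \<le> 7 ^ n"
proof -
  have UNIV_li: "UNIV = {LB, LI, LO, LBD, LID, LBH, LIH}"
    using li_label.exhaust by auto
  then have "finite (UNIV :: li_label set)" by (metis finite.emptyI finite.insertI)
  then have "M_Li n \<le> card {xs. set xs \<subseteq> (UNIV :: li_label set) \<and> length xs = n}"
    unfolding M_Li_def by (intro card_mono finite_lists_length_eq) auto
  also have "\<dots> = card (UNIV :: li_label set) ^ n"
    by (rule card_lists_length_eq) (simp add: UNIV_li)
  also have "card (UNIV :: li_label set) = 7" by (simp add: UNIV_li)
  finally show ?thesis .
qed

lemma components_singleton: "components {a} = {{a}}"
proof (intro equalityI subsetI)
  fix C assume "C \<in> components {a}"
  then obtain b c where "b \<le> c" "C = {b..c}" "{b..c} \<subseteq> {a}"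
    unfolding components_def by blast
  moreover from this have "b \<in> {a}" "c \<in> {a}" by auto
  ultimately show "C \<in> {{a}}" by simp
next
  fix C assume "C \<in> {{a}}"
  then have "a \<le> a \<and> C = {a..a} \<and> C \<subseteq> {a} \<and> (a = 0 \<or> a - 1 \<notin> {a}) \<and> Suc a \<notin> {a}" by auto
  then show "C \<in> components {a}" unfolding components_def by blast
qed

text \<open>The empty combination gives \<open>LO\<close> and the mention {1} gives
  \<open>LB\<close>. Having two encodings of a single word makes the linear-chain rate strictly
  positive, as a denominator must be.\<close>

lemma M_Li_1_ge: "2 \<le> M_Li 1"
proof -
  have "{x \<in> {{1}}. 1 \<in> x} = {{1::nat}}" by auto
  then have "li_label_at {} 1 = LO" "li_label_at {{1}} 1 = LB"
    by (simp_all add: li_label_at_def contiguous_def components_singleton)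
  then have "li_encoding 1 {} = [LO]" "li_encoding 1 {{1}} = [LB]"
    by (simp_all add: li_encoding_def)
  moreover have "{} \<in> mention_combinations 1" "{{1}} \<in> mention_combinations 1"
    by (auto simp: mention_combinations_def mentions_def components_singleton)
  ultimately have "{[LO], [LB]} \<subseteq> li_encoding 1 ` mention_combinations 1"
    by (metis empty_subsetI imageI insert_subset)
  then have "card {[LO], [LB]} \<le> M_Li 1"
    unfolding M_Li_def by (intro card_mono) (auto simp: finite_mention_combinations)
  then show ?thesis by simp
qed

lemma M_Li_pos: "1 \<le> n \<Longrightarrow> 1 \<le> M_Li n"
proof (induction n rule: dec_induct)
  case base
  then show ?case using M_Li_1_ge by simp
next
  case (step n)
  have "1 * 1 \<le> M_Li n * M_Li 1" using step.IH M_Li_1_ge by (intro mult_mono) auto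
  also have "\<dots> \<le> M_Li (n + 1)" by (rule M_Li_supermult)
  finally show ?case by simp
qed


section \<open>Concatenation in the Shared model\<close>

lemma mem_sh_nodes [simp]:
  "NX \<in> sh_nodes n"
  "NA k \<in> sh_nodes n \<longleftrightarrow> k \<in> {1..n}"
  "NE k \<in> sh_nodes n \<longleftrightarrow> k \<in> {1..n}"
  "NT k \<in> sh_nodes n \<longleftrightarrow> k \<in> {1..n}"
  "NB i k \<in> sh_nodes n \<longleftrightarrow> i \<in> {0, 1, 2} \<and> k \<in> {1..n}"
  "NO i k \<in> sh_nodes n \<longleftrightarrow> i \<in> {1, 2} \<and> k \<in> {1..n}"
  unfolding sh_nodes_def by auto

lemma sh_hyperedges_parent:
  assumes "e \<in> sh_hyperedges n"
  shows "fst e \<in> sh_nodes n - {NX}"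
  using assms by (cases e) (auto elim: sh_hyperedges.cases)

inductive_cases A_hyperedgeE: "(NA k, S) \<in> sh_hyperedges n"
inductive_cases E_hyperedgeE: "(NE k, S) \<in> sh_hyperedges n"
inductive_cases T_hyperedgeE: "(NT k, S) \<in> sh_hyperedges n"

context
  fixes n V H
  assumes G: "entity_encoded_hypergraph n (V, H)"
begin

lemma eeh_edge: "v \<in> V \<Longrightarrow> v \<noteq> NX \<Longrightarrow> \<exists>S. (v, S) \<in> H"
  using G unfolding entity_encoded_hypergraph_def by (auto dest!: bspec ex1_implies_ex)

lemma eeh_edge_unique: "(v, S) \<in> H \<Longrightarrow> (v, S') \<in> H \<Longrightarrow> S = S'"
proof -
  assume *: "(v, S) \<in> H" "(v, S') \<in> H"
  then have "v \<in> V - {NX}"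
    using G sh_hyperedges_parent[of "(v, S)" n] unfolding entity_encoded_hypergraph_def by auto
  then have "\<exists>!e. e \<in> H \<and> fst e = v"
    using G unfolding entity_encoded_hypergraph_def by auto
  with * show "S = S'" by (metis fst_conv snd_conv)
qed

lemma eeh_H: "(v, S) \<in> H \<Longrightarrow> (v, S) \<in> sh_hyperedges n \<and> v \<in> V \<and> S \<subseteq> V"
  using G unfolding entity_encoded_hypergraph_def by fastforce

lemma eeh_V: "V \<subseteq> sh_nodes n" "NA 1 \<in> V"
  using G unfolding entity_encoded_hypergraph_def by auto

lemma eeh_reach: "v \<in> V \<Longrightarrow> (NA 1, v) \<in> (hyperedge_steps H)\<^sup>*"
  using G unfolding entity_encoded_hypergraph_def by auto

text \<open>Before the last position the only hyperedge of an \<open>NA\<close> node leads on to the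
  next \<open>NA\<close> node, so the whole chain is forced.\<close>

lemma eeh_A: "1 \<le> k \<Longrightarrow> k \<le> n \<Longrightarrow> NA k \<in> V"
proof (induction k rule: dec_induct)
  case base
  show ?case using eeh_V by simp
next
  case (step k)
  then obtain S where "(NA k, S) \<in> H" using eeh_edge[of "NA k"] by auto
  with step.prems show ?case using eeh_H[of "NA k" S] by (auto elim!: A_hyperedgeE)
qed

lemma eeh_n_pos: "1 \<le> n"
  using eeh_V by auto

lemma eeh_A_last: "(NA n, {NE n}) \<in> H"
proof -
  obtain S where "(NA n, S) \<in> H" using eeh_edge[OF eeh_A] eeh_n_pos by auto
  then show ?thesis using eeh_H[of "NA n" S] by (auto elim!: A_hyperedgeE)
qed

text \<open>At the last position all continuations to the right are missing, so \<open>NT n\<close>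
  leads to \<open>NX\<close> either directly or through \<open>NB 0 n\<close>.\<close>

lemma eeh_NX: "NX \<in> V"
proof -
  have "NE n \<in> V" using eeh_H[OF eeh_A_last] by simp
  then obtain S where "(NE n, S) \<in> H" using eeh_edge by blast
  then have "NT n \<in> V" using eeh_H[of "NE n" S] by (auto elim!: E_hyperedgeE)
  then obtain S where S: "(NT n, S) \<in> H" using eeh_edge by blast
  then have "S = {NX} \<or> S = {NB 0 n}" using eeh_H[of "NT n" S] by (auto elim!: T_hyperedgeE)
  then show ?thesis
  proof
    assume "S = {NX}"
    then show ?thesis using eeh_H[OF S] by simp
  next
    assume "S = {NB 0 n}"
    then have "NB 0 n \<in> V" using eeh_H[OF S] by simp
    then obtain S' where S': "(NB 0 n, S') \<in> H" using eeh_edge by blast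
    have "(NB 0 n, S') \<in> sh_hyperedges n" using eeh_H[OF S'] by simp
    then have "S' \<noteq> {} \<and> S' \<subseteq> {NB 0 (Suc n), NO (Suc 0) (Suc n), NX} \<inter> sh_nodes n"
      by (cases rule: sh_hyperedges.cases) simp_all
    moreover have "{NB 0 (Suc n), NO (Suc 0) (Suc n), NX} \<inter> sh_nodes n = {NX}" by auto
    ultimately have "NX \<in> S'" by blast
    then show ?thesis using eeh_H[OF S'] by blast
  qed
qed

text \<open>Every node other than \<open>NX\<close> is the parent of a hyperedge, so the hyperedges
  determine the hypergraph. Counting and injectivity arguments may therefore look at hyperedges
  alone.\<close>

lemma eeh_nodes_eq: "V = insert NX (fst ` H)"
  using eeh_NX eeh_edge eeh_H by force

end

section \<open>Translation and gluing of hypergraphs\<close>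

fun shift_node :: "nat \<Rightarrow> sh_node \<Rightarrow> sh_node" where
  "shift_node d (NA k) = NA (d + k)"
| "shift_node d (NE k) = NE (d + k)"
| "shift_node d (NT k) = NT (d + k)"
| "shift_node d (NB i k) = NB i (d + k)"
| "shift_node d (NO i k) = NO i (d + k)"
| "shift_node d NX = NX"

definition shift_edge :: "nat \<Rightarrow> sh_node \<times> sh_node set \<Rightarrow> sh_node \<times> sh_node set" where
  "shift_edge d = map_prod (shift_node d) ((`) (shift_node d))"

lemma shift_node_eq_NX [simp]: "shift_node d v = NX \<longleftrightarrow> v = NX"
  by (cases v) auto

lemma inj_shift_node: "inj (shift_node d)"
proof (rule injI)
  fix v w assume "shift_node d v = shift_node d w"
  then show "v = w" by (cases v; cases w) auto
qed

lemma inj_shift_edge: "inj (shift_edge d)"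
  unfolding shift_edge_def using inj_shift_node[of d]
  by (auto simp: inj_def inj_image_eq_iff)

lemma shift_node_mem:
  "v \<in> sh_nodes n \<Longrightarrow> shift_node d v \<in> sh_nodes (d + n)"
  by (cases v) auto

text \<open>Translation moves a position k \<ge> 1 past d. This tells the two halves of a glued
  hypergraph apart.\<close>

lemma shift_node_notin:
  "v \<in> sh_nodes n \<Longrightarrow> v \<noteq> NX \<Longrightarrow> shift_node d v \<notin> sh_nodes d"
  by (cases v) auto

lemma sh_nodes_mono: "sh_nodes m \<subseteq> sh_nodes (m + n)"
  unfolding sh_nodes_def by auto

text \<open>\<open>NA m\<close> is excepted because its hyperedge is special to the last position;
  for the other parents a longer sentence can only add admissible children.\<close>

lemma sh_hyperedges_mono:
  assumes "(p, S) \<in> sh_hyperedges m" "p \<noteq> NA m"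
  shows "(p, S) \<in> sh_hyperedges (m + n)"
  using assms
  by (cases rule: sh_hyperedges.cases)
    (auto intro!: sh_hyperedges.intros intro: subsetD[OF sh_nodes_mono])

lemma sh_hyperedges_shift:
  assumes "e \<in> sh_hyperedges n"
  shows "shift_edge d e \<in> sh_hyperedges (d + n)"
proof -
  obtain p S where e: "e = (p, S)" by (cases e)
  with assms have "(p, S) \<in> sh_hyperedges n" by simp
  have nodes: "shift_node d ` T \<subseteq> sh_nodes (d + n)" if "T \<subseteq> sh_nodes n" for T
    using that by (auto intro: shift_node_mem)
  from \<open>(p, S) \<in> _\<close> have "(shift_node d p, shift_node d ` S) \<in> sh_hyperedges (d + n)"
  proof (cases rule: sh_hyperedges.cases)
    case (A_step k)
    then show ?thesis using sh_hyperedges.A_step[of "d + k" "d + n"] by simp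
  next
    case A_last
    then show ?thesis using sh_hyperedges.A_last[of "d + n"] by simp
  next
    case (B_01 k i)
    then have "shift_node d ` S \<subseteq> {NB i (Suc (d + k)), NO (Suc i) (Suc (d + k)), NX} \<inter> sh_nodes (d + n)"
      using image_mono[of S "{NB i (Suc k), NO (Suc i) (Suc k), NX}" "shift_node d"] nodes[of S] by simp
    with B_01 show ?thesis by (auto intro!: sh_hyperedges.B_01)
  next
    case (B_2 k)
    then have "shift_node d ` S \<subseteq> {NB 2 (Suc (d + k)), NX} \<inter> sh_nodes (d + n)"
      using image_mono[of S "{NB 2 (Suc k), NX}" "shift_node d"] nodes[of S] by simp
    with B_2 show ?thesis by (auto intro!: sh_hyperedges.B_2)
  next
    case (O_12 k i)
    then have "shift_node d ` S \<subseteq> {NO i (Suc (d + k)), NB i (Suc (d + k))} \<inter> sh_nodes (d + n)"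
      using image_mono[of S "{NO i (Suc k), NB i (Suc k)}" "shift_node d"] nodes[of S] by simp
    with O_12 show ?thesis by (auto intro!: sh_hyperedges.O_12)
  qed (auto intro: sh_hyperedges.intros)
  then show ?thesis by (simp add: e shift_edge_def)
qed

lemma hyperedge_steps_shift:
  assumes "(v, w) \<in> (hyperedge_steps H)\<^sup>*"
  shows "(shift_node d v, shift_node d w) \<in> (hyperedge_steps (shift_edge d ` H))\<^sup>*"
  using assms
proof (induction rule: rtrancl_induct)
  case (step w x)
  then have "(shift_node d w, shift_node d x) \<in> hyperedge_steps (shift_edge d ` H)"
    unfolding hyperedge_steps_def shift_edge_def by force
  with step.IH show ?case by simp
qed simp

text \<open>The chain of \<open>NA\<close> nodes is prolonged: the last one of the first hypergraph
  gains the child \<open>NA (Suc m)\<close>, which is the translated root of the second. The leaf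
  \<open>NX\<close> has no position and is shared by both halves.\<close>

fun sh_append :: "nat \<Rightarrow> sh_node set \<times> (sh_node \<times> sh_node set) set \<Rightarrow>
    sh_node set \<times> (sh_node \<times> sh_node set) set \<Rightarrow> sh_node set \<times> (sh_node \<times> sh_node set) set" where
  "sh_append m (V1, H1) (V2, H2) =
    (V1 \<union> shift_node m ` V2,
     insert (NA m, {NE m, NA (Suc m)}) (H1 - {(NA m, {NE m})}) \<union> shift_edge m ` H2)"

text \<open>Apart from the hyperedge at \<open>NA m\<close> the two halves keep their hyperedges,
  and the positions of the parents separate them. The second half is reached through the new link
  from \<open>NA m\<close> to \<open>NA (Suc m)\<close>.\<close>

lemma eeh_append:
  assumes G1: "entity_encoded_hypergraph m (V1, H1)" and G2: "entity_encoded_hypergraph n (V2, H2)"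
  shows "entity_encoded_hypergraph (m + n) (sh_append m (V1, H1) (V2, H2))"
proof -
  note G1' = eeh_edge[OF G1] eeh_H[OF G1] eeh_V[OF G1]
  note G2' = eeh_edge[OF G2] eeh_H[OF G2] eeh_V[OF G2]
  define V where "V = V1 \<union> shift_node m ` V2"
  define J where "J = insert (NA m, {NE m, NA (Suc m)}) (H1 - {(NA m, {NE m})})"
  define H where "H = J \<union> shift_edge m ` H2"
  have m: "1 \<le> m" and n: "1 \<le> n" using eeh_n_pos[OF G1] eeh_n_pos[OF G2] by auto
  have NAm: "NA m \<in> V1" using eeh_A[OF G1] m by simp
  have NEm: "NE m \<in> V1" using eeh_H[OF G1 eeh_A_last[OF G1]] by simp
  have NA_Suc: "NA (Suc m) \<in> shift_node m ` V2"
    using G2' by (auto intro!: image_eqI[of _ _ "NA 1"])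
  have J_cases: "(v = NA m \<and> S = {NE m, NA (Suc m)}) \<or> (v \<noteq> NA m \<and> (v, S) \<in> H1)"
    if "(v, S) \<in> J" for v S
    using that eeh_edge_unique[OF G1 eeh_A_last[OF G1]] unfolding J_def by blast
  have J_parent: "v \<in> V1 \<and> v \<in> sh_nodes m \<and> v \<noteq> NX" if "(v, S) \<in> J" for v S
    using J_cases[OF that] NAm m G1' sh_hyperedges_parent by fastforce
  have s_parent: "fst e \<in> shift_node m ` V2 \<and> fst e \<notin> sh_nodes m" if e: "e \<in> shift_edge m ` H2" for e
  proof -
    obtain v S where vS: "(v, S) \<in> H2" "e = shift_edge m (v, S)" using e by auto
    then have "v \<in> V2" "v \<in> sh_nodes n" "v \<noteq> NX"
      using eeh_H[OF G2 vS(1)] sh_hyperedges_parent[of "(v, S)" n] by auto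
    then show ?thesis using vS shift_node_notin[of v n m] by (auto simp: shift_edge_def)
  qed
  have "V \<subseteq> sh_nodes (m + n)"
    unfolding V_def using eeh_V(1)[OF G1] eeh_V(1)[OF G2] sh_nodes_mono[of m n]
    by (auto intro: shift_node_mem)
  moreover have "H \<subseteq> sh_hyperedges (m + n)"
  proof -
    have "(v, S) \<in> sh_hyperedges (m + n)" if "(v, S) \<in> J" for v S
      using J_cases[OF that]
    proof
      assume "v = NA m \<and> S = {NE m, NA (Suc m)}"
      then show ?thesis using sh_hyperedges.A_step[of m "m + n"] m n by simp
    next
      assume "v \<noteq> NA m \<and> (v, S) \<in> H1"
      then show ?thesis using eeh_H[OF G1] sh_hyperedges_mono by blast
    qed
    moreover have "shift_edge m e \<in> sh_hyperedges (m + n)" if "e \<in> H2" for e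
      using that eeh_H[OF G2] sh_hyperedges_shift[of e n m] by (cases e) auto
    ultimately show ?thesis unfolding H_def by auto
  qed
  moreover have "NA 1 \<in> V" unfolding V_def using G1' by simp
  moreover have "\<exists>!e. e \<in> H \<and> fst e = v" if v: "v \<in> V - {NX}" for v
  \<comment> \<open>Since v is not \<open>NX\<close>, the only node common to both halves, this
    decides which half supplies its hyperedge.\<close>
  proof (cases "v \<in> sh_nodes m")
    case True
    then have "v \<in> V1" using v shift_node_notin[of _ n m] G2' unfolding V_def by auto
    then obtain S where "(v, S) \<in> J"
      using eeh_edge[OF G1, of v] v unfolding J_def by blast
    moreover have "S' = S" if "(v, S') \<in> H" for S'
    proof -
      have "(v, S') \<in> J" using that True s_parent unfolding H_def by fastforce
      then show ?thesis
        using J_cases[OF \<open>(v, S) \<in> J\<close>] J_cases[of v S'] eeh_edge_unique[OF G1] by blast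
    qed
    moreover have "J \<subseteq> H" unfolding H_def by blast
    ultimately show ?thesis by (intro ex1I[of _ "(v, S)"]) (auto simp: prod_eq_iff)
  next
    case False
    then obtain w where w: "v = shift_node m w" "w \<in> V2" "w \<noteq> NX"
      using v G1' unfolding V_def by auto
    then obtain S where S: "(w, S) \<in> H2" using eeh_edge[OF G2] by blast
    show ?thesis
    proof (intro ex1I[of _ "shift_edge m (w, S)"] conjI)
      show "shift_edge m (w, S) \<in> H" using S unfolding H_def by blast
      show "fst (shift_edge m (w, S)) = v" by (simp add: shift_edge_def w)
      fix e assume e: "e \<in> H \<and> fst e = v"
      then have "e \<in> shift_edge m ` H2" using J_parent False unfolding H_def by (cases e) auto
      then obtain w' S' where e': "(w', S') \<in> H2" "e = shift_edge m (w', S')" by auto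
      then have "w' = w" using e w inj_shift_node[of m] by (auto simp: shift_edge_def inj_def)
      then show "e = shift_edge m (w, S)" using e' S eeh_edge_unique[OF G2] by blast
    qed
  qed
  moreover have "fst e \<in> V \<and> snd e \<subseteq> V" if e_H: "e \<in> H" for e
  proof -
    consider "e \<in> J" | "e \<in> shift_edge m ` H2" using e_H unfolding H_def by blast
    then show ?thesis
    proof cases
      case 1
      then obtain v S where e: "e = (v, S)" "(v, S) \<in> J" by (cases e) auto
      show ?thesis
        using J_cases[OF e(2)] NAm NEm NA_Suc eeh_H[OF G1, of v S] unfolding V_def e by auto
    next
      case 2
      then show ?thesis using eeh_H[OF G2] unfolding V_def shift_edge_def by fastforce
    qed
  qed
  moreover have "(NA 1, v) \<in> (hyperedge_steps H)\<^sup>*" if "v \<in> V" for v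
  proof -
    \<comment> \<open>The replaced hyperedge only gained a child, so all paths of the first
      hypergraph survive.\<close>
    have "hyperedge_steps H1 \<subseteq> hyperedge_steps H"
      unfolding hyperedge_steps_def H_def J_def by auto
    then have left: "(NA 1, w) \<in> (hyperedge_steps H)\<^sup>*" if "w \<in> V1" for w
      using eeh_reach[OF G1 that] rtrancl_mono by blast
    have "hyperedge_steps (shift_edge m ` H2) \<subseteq> hyperedge_steps H"
      unfolding hyperedge_steps_def H_def by blast
    then have right: "(NA (Suc m), shift_node m w) \<in> (hyperedge_steps H)\<^sup>*" if "w \<in> V2" for w
      using hyperedge_steps_shift[OF eeh_reach[OF G2 that], of m] rtrancl_mono by auto
    have "(NA m, NA (Suc m)) \<in> hyperedge_steps H"
      unfolding hyperedge_steps_def H_def J_def by auto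
    with left[OF NAm] have "(NA 1, NA (Suc m)) \<in> (hyperedge_steps H)\<^sup>*" by simp
    with left right that show ?thesis unfolding V_def by (auto intro: rtrancl_trans)
  qed
  ultimately show ?thesis
    unfolding entity_encoded_hypergraph_def by (simp add: V_def H_def J_def)
qed

text \<open>The positions of the parents sort the hyperedges into the two halves. The only altered
  hyperedge is the one at \<open>NA m\<close>, whose original form is forced and can be put
  back.\<close>

lemma sh_append_recover:
  assumes G1: "entity_encoded_hypergraph m (V1, H1)" and G2: "entity_encoded_hypergraph n (V2, H2)"
  defines "H \<equiv> snd (sh_append m (V1, H1) (V2, H2))"
  shows "H1 = insert (NA m, {NE m}) {e \<in> H. fst e \<in> sh_nodes m - {NA m}}"
    and "shift_edge m ` H2 = {e \<in> H. fst e \<notin> sh_nodes m}"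
proof -
  have m: "1 \<le> m" using eeh_n_pos[OF G1] .
  define J where "J = insert (NA m, {NE m, NA (Suc m)}) (H1 - {(NA m, {NE m})})"
  have H: "H = J \<union> shift_edge m ` H2" by (simp add: H_def J_def)
  have H1: "fst e \<in> sh_nodes m \<and> (fst e = NA m \<longrightarrow> e = (NA m, {NE m}))" if "e \<in> H1" for e
    using that eeh_H[OF G1] sh_hyperedges_parent[of e m] eeh_edge_unique[OF G1 eeh_A_last[OF G1]]
    by (cases e) auto
  have J: "fst e \<in> sh_nodes m" if "e \<in> J" for e
    using that H1 m unfolding J_def by fastforce
  have H2: "fst e \<notin> sh_nodes m" if "e \<in> shift_edge m ` H2" for e
  proof -
    obtain v S where vS: "(v, S) \<in> H2" "e = shift_edge m (v, S)" using \<open>e \<in> _\<close> by auto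
    then show ?thesis
      using eeh_H[OF G2 vS(1)] sh_hyperedges_parent[of "(v, S)" n] shift_node_notin[of v n m]
      by (auto simp: shift_edge_def)
  qed
  have "{e \<in> H. fst e \<in> sh_nodes m - {NA m}} = {e \<in> J. fst e \<noteq> NA m}"
    unfolding H using J H2 by blast
  also have "\<dots> = H1 - {(NA m, {NE m})}"
    unfolding J_def using H1 by fastforce
  finally show "H1 = insert (NA m, {NE m}) {e \<in> H. fst e \<in> sh_nodes m - {NA m}}"
    using eeh_A_last[OF G1] by blast
  show "shift_edge m ` H2 = {e \<in> H. fst e \<notin> sh_nodes m}"
    unfolding H using J H2 by blast
qed

section \<open>Finiteness and an exponential upper bound\<close>

lemma sh_hyperedges_subset:
  "sh_hyperedges n \<subseteq> (\<Union>k\<in>{1..n}. {NA k, NE k, NT k, NB 0 k, NB 1 k, NB 2 k, NO 1 k, NO 2 k} \<times>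
    Pow {NX, NA (Suc k), NE k, NT k, NB 0 k, NB 0 (Suc k), NB 1 (Suc k), NB 2 (Suc k),
      NO 1 (Suc k), NO 2 (Suc k)})"
proof
  fix e assume e: "e \<in> sh_hyperedges n"
  obtain p S where pS: "e = (p, S)" by (cases e)
  with e have "(p, S) \<in> sh_hyperedges n" by simp
  then show "e \<in> (\<Union>k\<in>{1..n}. {NA k, NE k, NT k, NB 0 k, NB 1 k, NB 2 k, NO 1 k, NO 2 k} \<times>
    Pow {NX, NA (Suc k), NE k, NT k, NB 0 k, NB 0 (Suc k), NB 1 (Suc k), NB 2 (Suc k),
      NO 1 (Suc k), NO 2 (Suc k)})"
    by (cases rule: sh_hyperedges.cases) (auto simp: pS numeral_2_eq_2)
qed

lemma finite_sh_hyperedges: "finite (sh_hyperedges n)"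
  by (rule finite_subset[OF sh_hyperedges_subset]) auto

text \<open>Each position offers 8 parents, and the children of all of them come from a common list
  of 10 nodes.\<close>

lemma card_sh_hyperedges_le: "card (sh_hyperedges n) \<le> 8 * 2 ^ 10 * n"
proof -
  define P where "P k = {NA k, NE k, NT k, NB 0 k, NB 1 k, NB 2 k, NO 1 k, NO 2 k}" for k
  define Q where "Q k = {NX, NA (Suc k), NE k, NT k, NB 0 k, NB 0 (Suc k), NB 1 (Suc k),
    NB 2 (Suc k), NO 1 (Suc k), NO 2 (Suc k)}" for k
  have "sh_hyperedges n \<subseteq> (\<Union>k\<in>{1..n}. P k \<times> Pow (Q k))"
    using sh_hyperedges_subset unfolding P_def Q_def .
  then have "card (sh_hyperedges n) \<le> card (\<Union>k\<in>{1..n}. P k \<times> Pow (Q k))"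
    by (intro card_mono) (auto simp: P_def Q_def)
  also have "\<dots> \<le> (\<Sum>k=1..n. card (P k \<times> Pow (Q k)))"
    by (rule card_UN_le) simp
  also have "\<dots> = (\<Sum>k=1..n. 8 * 2 ^ 10)"
    by (simp add: card_cartesian_product card_Pow P_def Q_def)
  finally show ?thesis by simp
qed

lemma inj_on_snd_eeh: "inj_on snd {G. entity_encoded_hypergraph n G}"
proof (rule inj_onI)
  fix G G' assume *: "G \<in> {G. entity_encoded_hypergraph n G}"
    "G' \<in> {G. entity_encoded_hypergraph n G}" "snd G = snd G'"
  obtain V H V' H' where G: "G = (V, H)" "G' = (V', H')" by (cases G; cases G')
  with * have "V = insert NX (fst ` H)" "V' = insert NX (fst ` H')"
    by (auto dest!: eeh_nodes_eq)
  with * G show "G = G'" by simp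
qed

lemma snd_eeh_subset: "snd ` {G. entity_encoded_hypergraph n G} \<subseteq> Pow (sh_hyperedges n)"
  unfolding entity_encoded_hypergraph_def by auto

lemma finite_eeh: "finite {G. entity_encoded_hypergraph n G}"
  using inj_on_snd_eeh snd_eeh_subset
  by (rule inj_on_finite) (simp add: finite_sh_hyperedges)

text \<open>A hypergraph is determined by a subset of linearly many hyperedges. The resulting
  exponential bound keeps the growth rate of the Shared model finite.\<close>

lemma M_Sh_le:
  obtains c where "\<And>n. M_Sh n \<le> (2 ^ c) ^ n"
proof -
  have "\<exists>c. \<forall>n. card (sh_hyperedges n) \<le> c * n"
    using card_sh_hyperedges_le by blast
  then obtain c where c: "\<And>n. card (sh_hyperedges n) \<le> c * n" by blast
  have "M_Sh n \<le> (2 ^ c) ^ n" for n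
  proof -
    have "M_Sh n \<le> card (Pow (sh_hyperedges n))"
      unfolding M_Sh_def using inj_on_snd_eeh snd_eeh_subset
      by (rule card_inj_on_le) (simp add: finite_sh_hyperedges)
    also have "\<dots> = 2 ^ card (sh_hyperedges n)"
      by (simp add: card_Pow finite_sh_hyperedges)
    also have "\<dots> \<le> 2 ^ (c * n)" using c by (intro power_increasing) auto
    finally show ?thesis by (simp add: power_mult)
  qed
  then show ?thesis by (rule that)
qed

text \<open>Gluing is injective: both hyperedge sets can be recovered from the result, and they
  determine the node sets.\<close>

lemma M_Sh_supermult: "M_Sh m * M_Sh n \<le> M_Sh (m + n)"
proof -
  let ?E = "\<lambda>n. {G. entity_encoded_hypergraph n G}"
  let ?f = "\<lambda>(G1, G2). sh_append m G1 G2"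
  have "inj_on ?f (?E m \<times> ?E n)"
  proof (rule inj_onI)
    fix x y assume xy: "x \<in> ?E m \<times> ?E n" "y \<in> ?E m \<times> ?E n" "?f x = ?f y"
    obtain V1 H1 V2 H2 where x: "x = ((V1, H1), (V2, H2))" by (metis surj_pair)
    obtain V1' H1' V2' H2' where y: "y = ((V1', H1'), (V2', H2'))" by (metis surj_pair)
    have G: "entity_encoded_hypergraph m (V1, H1)" "entity_encoded_hypergraph n (V2, H2)"
      "entity_encoded_hypergraph m (V1', H1')" "entity_encoded_hypergraph n (V2', H2')"
      and eq: "sh_append m (V1, H1) (V2, H2) = sh_append m (V1', H1') (V2', H2')"
      using xy by (simp_all add: x y del: sh_append.simps)
    have "H1 = H1'" "shift_edge m ` H2 = shift_edge m ` H2'"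
      using sh_append_recover[OF G(1,2)] sh_append_recover[OF G(3,4)] eq by metis+
    then have "H1 = H1'" "H2 = H2'" by (simp_all add: inj_image_eq_iff[OF inj_shift_edge])
    then show "x = y"
      using G[THEN eeh_nodes_eq] by (simp add: x y)
  qed
  moreover have "?f ` (?E m \<times> ?E n) \<subseteq> ?E (m + n)"
    using eeh_append by auto
  ultimately have "card (?E m \<times> ?E n) \<le> card (?E (m + n))"
    using finite_eeh by (rule card_inj_on_le)
  then show ?thesis by (simp add: M_Sh_def card_cartesian_product)
qed


section \<open>A large family of hypergraphs\<close>

text \<open>All hypergraphs of the family share the node set \<open>wide_nodes n\<close>, which the mandatory children
  make reachable; an arbitrary subset of \<open>free_nodes n\<close> can then be chosen for the nodes whose
  hyperedge deviates from the default, without changing the set of reachable nodes.\<close>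

definition wide_nodes :: "nat \<Rightarrow> sh_node set" where
  "wide_nodes n = {NX} \<union> NA ` {1..n} \<union> NE ` {1..n} \<union> NT ` {1..n}
    \<union> NB 0 ` {1..n} \<union> NO 1 ` {2..<n} \<union> NB 1 ` {3..n}"

text \<open>The ranges leave out positions without a choice: \<open>NT 1\<close> has to start a
  mention so that \<open>NB 0 1\<close> is reachable, the \<open>NB\<close> nodes at n have to end,
  and a gap at n - 1 has to close. For n \<ge> 3 this leaves 4 * n - 8 binary choices.\<close>

definition free_nodes :: "nat \<Rightarrow> sh_node set" where
  "free_nodes n = NT ` {2..n} \<union> NB 0 ` {1..<n} \<union> NO 1 ` {2..<n - 1} \<union> NB 1 ` {3..<n}"

lemma mem_wide_nodes [simp]:
  "NX \<in> wide_nodes n"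
  "NA k \<in> wide_nodes n \<longleftrightarrow> k \<in> {1..n}"
  "NE k \<in> wide_nodes n \<longleftrightarrow> k \<in> {1..n}"
  "NT k \<in> wide_nodes n \<longleftrightarrow> k \<in> {1..n}"
  "NB i k \<in> wide_nodes n \<longleftrightarrow> i = 0 \<and> k \<in> {1..n} \<or> i = 1 \<and> k \<in> {3..n}"
  "NO i k \<in> wide_nodes n \<longleftrightarrow> i = 1 \<and> k \<in> {2..<n}"
  unfolding wide_nodes_def by auto

lemma mem_free_nodes [simp]:
  "NX \<notin> free_nodes n" "NA k \<notin> free_nodes n" "NE k \<notin> free_nodes n"
  "NT k \<in> free_nodes n \<longleftrightarrow> k \<in> {2..n}"
  "NB i k \<in> free_nodes n \<longleftrightarrow> i = 0 \<and> k \<in> {1..<n} \<or> i = 1 \<and> k \<in> {3..<n}"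
  "NO i k \<in> free_nodes n \<longleftrightarrow> i = 1 \<and> k \<in> {2..<n - 1}"
  unfolding free_nodes_def by auto

text \<open>Membership in S adds one optional child: \<open>NX\<close> at \<open>NB 0 k\<close>, and
  the node prolonging the component or gap at \<open>NB 1 k\<close> and \<open>NO 1 k\<close>. At
  \<open>NT k\<close> it instead replaces \<open>NX\<close> by \<open>NB 0 k\<close>. A gap node is
  offered only strictly before n, since a component must follow it.\<close>

fun wide_children :: "nat \<Rightarrow> sh_node set \<Rightarrow> sh_node \<Rightarrow> sh_node set" where
  "wide_children n S (NA k) = (if k < n then {NE k, NA (Suc k)} else {NE k})"
| "wide_children n S (NE k) = {NT k}"
| "wide_children n S (NT k) = (if k = 1 \<or> NT k \<in> S then {NB 0 k} else {NX})"
| "wide_children n S (NB i k) =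
    (if i = 0 then
       (if k < n then {NB 0 (Suc k)} else {}) \<union> (if Suc k < n then {NO 1 (Suc k)} else {})
       \<union> (if k = n \<or> NB 0 k \<in> S then {NX} else {})
     else {NX} \<union> (if NB 1 k \<in> S then {NB 1 (Suc k)} else {}))"
| "wide_children n S (NO i k) = {NB 1 (Suc k)} \<union> (if NO 1 k \<in> S then {NO 1 (Suc k)} else {})"
| "wide_children n S NX = {}"

definition wide_edges :: "nat \<Rightarrow> sh_node set \<Rightarrow> (sh_node \<times> sh_node set) set" where
  "wide_edges n S = (\<lambda>v. (v, wide_children n S v)) ` (wide_nodes n - {NX})"

lemma wide_edges_subset:
  assumes "S \<subseteq> free_nodes n"
  shows "wide_edges n S \<subseteq> sh_hyperedges n"
proof
  fix e assume "e \<in> wide_edges n S"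
  then obtain v where v: "v \<in> wide_nodes n" "v \<noteq> NX" "e = (v, wide_children n S v)"
    unfolding wide_edges_def by auto
  have "(v, wide_children n S v) \<in> sh_hyperedges n"
  proof (cases v)
    case (NA k)
    then have "k < n \<or> k = n" "1 \<le> k" using v by auto
    then show ?thesis using NA by (auto intro: sh_hyperedges.A_step sh_hyperedges.A_last)
  next
    case (NB i k)
    then consider "i = 0" "k \<in> {1..n}" | "i = 1" "k \<in> {3..n}"
      using v by auto
    then show ?thesis
    proof cases
      case 1
      then show ?thesis using NB by (auto intro!: sh_hyperedges.B_01)
    next
      case 2
      \<comment> \<open>The optional child \<open>NB 1 (Suc k)\<close> exists only before the last
        position, which is where the range of free nodes stops.\<close>
      then have "NB 1 k \<in> S \<Longrightarrow> k < n" using assms by auto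
      with 2 show ?thesis using NB by (auto intro!: sh_hyperedges.B_01)
    qed
  next
    case (NO i k)
    then show ?thesis using v by (auto intro!: sh_hyperedges.O_12)
  qed (use v in \<open>auto intro: sh_hyperedges.intros\<close>)
  then show "e \<in> sh_hyperedges n" by (simp add: v)
qed

lemma wide_children_subset:
  assumes "S \<subseteq> free_nodes n" "v \<in> wide_nodes n"
  shows "wide_children n S v \<subseteq> wide_nodes n"
  using assms(2) subsetD[OF assms(1), of v] by (cases v) auto

text \<open>Only mandatory children are followed, so the choice of S has no influence: along the
  \<open>NA\<close> chain, from \<open>NT 1\<close> to the right along \<open>NB 0\<close>, then one
  step each to \<open>NO 1\<close> and to \<open>NB 1\<close>; \<open>NX\<close> is reached from
  \<open>NB 0 n\<close>.\<close>

lemma wide_reachable: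
  assumes n: "1 \<le> n" and "v \<in> wide_nodes n"
  shows "(NA 1, v) \<in> (hyperedge_steps (wide_edges n S))\<^sup>*" (is "(_, v) \<in> ?R\<^sup>*")
proof -
  have reach: "(NA 1, w) \<in> ?R\<^sup>*"
    if "(NA 1, v) \<in> ?R\<^sup>*" "v \<in> wide_nodes n - {NX}" "w \<in> wide_children n S v" for v w
  proof -
    have "(v, w) \<in> ?R" using that unfolding hyperedge_steps_def wide_edges_def by blast
    with that(1) show ?thesis by simp
  qed
  have A: "(NA 1, NA k) \<in> ?R\<^sup>*" if "1 \<le> k" "k \<le> n" for k
    using that
  proof (induction k rule: dec_induct)
    case (step k)
    then show ?case using reach[of "NA k"] by auto
  qed simp
  have E: "(NA 1, NE k) \<in> ?R\<^sup>*" if "1 \<le> k" "k \<le> n" for k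
    using that by (intro reach[OF A[of k]]) auto
  have T: "(NA 1, NT k) \<in> ?R\<^sup>*" if "1 \<le> k" "k \<le> n" for k
    using that by (intro reach[OF E[of k]]) auto
  have B0: "(NA 1, NB 0 k) \<in> ?R\<^sup>*" if "1 \<le> k" "k \<le> n" for k
    using that
  proof (induction k rule: dec_induct)
    case base
    then show ?case by (intro reach[OF T[of 1]]) auto
  next
    case (step k)
    then show ?case using reach[of "NB 0 k"] by auto
  qed
  have O1: "(NA 1, NO 1 k) \<in> ?R\<^sup>*" if "2 \<le> k" "k < n" for k
    using that by (intro reach[OF B0[of "k - 1"]]) auto
  have B1: "(NA 1, NB 1 k) \<in> ?R\<^sup>*" if "3 \<le> k" "k \<le> n" for k
    using that by (intro reach[OF O1[of "k - 1"]]) auto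
  have X: "(NA 1, NX) \<in> ?R\<^sup>*"
    using n by (intro reach[OF B0[of n]]) auto
  show ?thesis using assms(2) A E T B0 O1 B1 X by (cases v) auto
qed

lemma eeh_wide:
  assumes "1 \<le> n" "S \<subseteq> free_nodes n"
  shows "entity_encoded_hypergraph n (wide_nodes n, wide_edges n S)"
proof -
  have "wide_nodes n \<subseteq> sh_nodes n" by (auto simp: wide_nodes_def)
  moreover have "NA 1 \<in> wide_nodes n" using assms by simp
  moreover have "\<exists>!e. e \<in> wide_edges n S \<and> fst e = v" if "v \<in> wide_nodes n - {NX}" for v
    using that unfolding wide_edges_def by auto
  moreover have "fst e \<in> wide_nodes n \<and> snd e \<subseteq> wide_nodes n" if "e \<in> wide_edges n S" for e
    using that wide_children_subset[OF assms(2)] unfolding wide_edges_def by fastforce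
  ultimately show ?thesis
    using wide_edges_subset[OF assms(2)] wide_reachable[OF assms(1)]
    unfolding entity_encoded_hypergraph_def by simp
qed

text \<open>The set of children of a free node reveals whether the node belongs to S.\<close>

lemma inj_on_wide_edges: "inj_on (wide_edges n) (Pow (free_nodes n))"
proof (rule inj_onI)
  fix S S' assume S: "S \<in> Pow (free_nodes n)" "S' \<in> Pow (free_nodes n)"
    and eq: "wide_edges n S = wide_edges n S'"
  have "v \<in> S \<longleftrightarrow> v \<in> S'" if v: "v \<in> free_nodes n" for v
  proof -
    have "v \<in> wide_nodes n - {NX}" using v by (auto simp: free_nodes_def wide_nodes_def)
    then have "(v, wide_children n S v) \<in> wide_edges n S'"
      unfolding eq[symmetric] by (simp add: wide_edges_def)
    then have "wide_children n S v = wide_children n S' v"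
      by (auto simp: wide_edges_def)
    with v show ?thesis by (auto simp: free_nodes_def split: if_splits)
  qed
  with S show "S = S'" by blast
qed

lemma M_Sh_ge: "1 \<le> n \<Longrightarrow> 2 ^ card (free_nodes n) \<le> M_Sh n"
proof -
  assume n: "1 \<le> n"
  have "2 ^ card (free_nodes n) = card (Pow (free_nodes n))"
    by (simp add: card_Pow free_nodes_def)
  also have "\<dots> \<le> M_Sh n"
    unfolding M_Sh_def
  proof (rule card_inj_on_le)
    show "inj_on (\<lambda>S. (wide_nodes n, wide_edges n S)) (Pow (free_nodes n))"
      using inj_on_wide_edges by (auto simp: inj_on_def)
  qed (use n eeh_wide finite_eeh in auto)
  finally show ?thesis .
qed

lemma card_free_nodes_8: "card (free_nodes 8) = 24"
proof -
  have "card (free_nodes 8) = card (NT ` {2..8::nat}) + card (NB 0 ` {1..<8})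
    + card (NO 1 ` {2..<7}) + card (NB 1 ` {3..<8})"
    unfolding free_nodes_def by (subst card_Un_disjoint; auto)+
  then show ?thesis by (simp add: card_image inj_on_def)
qed

lemma M_Sh_8_gt: "7 ^ 8 < M_Sh 8"
  using M_Sh_ge[of 8] by (simp add: card_free_nodes_8)


section \<open>The relative ambiguity\<close>

theorem theorem4p1:
  "convergent (ambiguity_ratio M_Li M_Sh) \<and> relative_ambiguity M_Li M_Sh > 1"
proof -
  obtain L where L: "(\<lambda>n. ln (real (\<Sum>i=1..n. M_Li i)) / n) \<longlonglongrightarrow> L"
      "\<And>n. 1 \<le> n \<Longrightarrow> ln (real (M_Li n)) / n \<le> L" "L \<le> ln 7"
  proof (rule supermultiplicative_growth_rate[of M_Li 7])
    show "real (M_Li n) \<le> 7 ^ n" for n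
      using M_Li_le[of n] by (metis of_nat_le_iff of_nat_numeral of_nat_power)
  qed (use M_Li_supermult M_Li_pos in auto)
  obtain c where c: "\<And>n. M_Sh n \<le> (2 ^ c) ^ n" using M_Sh_le by blast
  obtain K where K: "(\<lambda>n. ln (real (\<Sum>i=1..n. M_Sh i)) / n) \<longlonglongrightarrow> K"
      "\<And>n. 1 \<le> n \<Longrightarrow> ln (real (M_Sh n)) / n \<le> K"
  proof (rule supermultiplicative_growth_rate[of M_Sh "2 ^ c"])
    show "real (M_Sh n) \<le> (2 ^ c) ^ n" for n
      using c[of n] by (metis of_nat_le_iff of_nat_numeral of_nat_power)
    show "1 \<le> M_Sh n" if "1 \<le> n" for n
      using M_Sh_ge[OF that] by (meson one_le_numeral one_le_power order_trans)
  qed (use M_Sh_supermult in auto)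
  have "0 < ln (real (M_Li 1))" using M_Li_1_ge by simp
  then have "0 < L" using L(2)[of 1] by simp
  \<comment> \<open>Every value of ln (M n) / n is a lower bound for the rate, so the single length
    8 separates the two models.\<close>
  have "ln 7 = ln (7 ^ 8 :: real) / 8" by (subst ln_realpow) simp_all
  also have "\<dots> < ln (real (M_Sh 8)) / 8"
    using M_Sh_8_gt by simp
  also have "\<dots> \<le> K" using K(2)[of 8] by simp
  finally have "L < K" using L(3) by simp
  \<comment> \<open>Dividing both logarithms by n does not change their quotient for n > 0 and makes
    numerator and denominator converge separately.\<close>
  have "(\<lambda>n. (ln (real (\<Sum>i=1..n. M_Sh i)) / n) / (ln (real (\<Sum>i=1..n. M_Li i)) / n)) \<longlonglongrightarrow> K / L"
    using K(1) L(1) \<open>0 < L\<close> by (intro tendsto_divide) auto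
  moreover have "\<forall>\<^sub>F n in sequentially.
      (ln (real (\<Sum>i=1..n. M_Sh i)) / n) / (ln (real (\<Sum>i=1..n. M_Li i)) / n)
      = ambiguity_ratio M_Li M_Sh n"
    using eventually_gt_at_top[of 0] by eventually_elim (simp add: ambiguity_ratio_def)
  ultimately have "ambiguity_ratio M_Li M_Sh \<longlonglongrightarrow> K / L"
    by (rule Lim_transform_eventually)
  then show ?thesis
    using \<open>0 < L\<close> \<open>L < K\<close> unfolding relative_ambiguity_def
    by (auto simp: convergent_def limI)
qed

end
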